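(* For every $S\subseteq\{123,321,231,312\}$ and every $n\ge0$, $$f_{S\cup\{132\}}(n,x)=f_{S\cup\{213\}}(n,x).$$ Hence, $S\cup\{132\}$ and $S\cup\{213\}$ are DD-Wilf equivalent.
   Context: $\mathfrak S_n$ is the set of permutations of $\{1,\dots,n\}$. For a set $T$ of patterns, $\operatorname{Av}_n(T)$ is the set of $\pi\in\mathfrak S_n$ having no subsequence order-isomorphic to any element of $T$. $\operatorname{DD}(\pi)$ is the number of indices $k$ with $\pi(k)<k<\pi^{-1}(k)$ (double deficiencies), and $f_T(n,x)=\sum_{\pi\in\operatorname{Av}_n(T)}x^{\operatorname{DD}(\pi)}$. Two sets of patterns $T,T'$ are DD-Wilf equivalent if $f_T(n,x)=f_{T'}(n,x)$ for every $n\ge0$. *)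

theory Defs
  imports "HOL-Combinatorics.Permutations" "HOL-Library.Sublist"
    "HOL-Computational_Algebra.Polynomial"
begin

text \<open>
  A permutation of \<open>{1..n}\<close> is a function \<open>\<pi>\<close> with \<open>\<pi> permutes {1..n}\<close>; a pattern is
  given by its one-line notation, so 132 is the list \<open>[1, 3, 2]\<close>.
\<close>

definition one_line :: "nat \<Rightarrow> (nat \<Rightarrow> nat) \<Rightarrow> nat list" where
  "one_line n \<pi> = map \<pi> [1..<Suc n]"

definition order_isomorphic :: "nat list \<Rightarrow> nat list \<Rightarrow> bool" where
  "order_isomorphic xs ys \<longleftrightarrow> length xs = length ys \<and>
     (\<forall>i<length xs. \<forall>j<length xs. xs ! i < xs ! j \<longleftrightarrow> ys ! i < ys ! j)"

definition contains_pattern :: "nat list \<Rightarrow> nat list \<Rightarrow> bool" where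
  "contains_pattern w \<sigma> \<longleftrightarrow> (\<exists>u. subseq u w \<and> order_isomorphic u \<sigma>)"

definition Av :: "nat \<Rightarrow> nat list set \<Rightarrow> (nat \<Rightarrow> nat) set" where
  "Av n T = {\<pi>. \<pi> permutes {1..n} \<and> (\<forall>\<sigma>\<in>T. \<not> contains_pattern (one_line n \<pi>) \<sigma>)}"

definition DD :: "nat \<Rightarrow> (nat \<Rightarrow> nat) \<Rightarrow> nat" where
  "DD n \<pi> = card {k \<in> {1..n}. \<pi> k < k \<and> k < inv \<pi> k}"

text \<open>The polynomial \<open>f\<^sub>T(n, x)\<close> in the indeterminate \<open>x\<close>.\<close>

definition DD_poly :: "nat list set \<Rightarrow> nat \<Rightarrow> int poly" where
  "DD_poly T n = (\<Sum>\<pi>\<in>Av n T. monom 1 (DD n \<pi>))"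

definition DD_Wilf_equivalent :: "nat list set \<Rightarrow> nat list set \<Rightarrow> bool" where
  "DD_Wilf_equivalent T T' \<longleftrightarrow> (\<forall>n. DD_poly T n = DD_poly T' n)"

end

theory Submission
  imports Defs
begin

text \<open>
  Reflect the plot of a permutation in the antidiagonal: with \<open>c k = n + 1 - k\<close> the point
  \<open>(k, \<pi> k)\<close> moves to \<open>(c (\<pi> k), c k)\<close>, so \<open>\<pi>\<close> becomes its reverse-complement-inverse
  \<open>c \<circ> \<pi>\<inverse> \<circ> c\<close>. This is an involution of the permutations of \<open>{1..n}\<close> with the following
  two properties.

  It preserves double deficiencies: \<open>k\<close> is one of \<open>\<pi>\<close> iff \<open>c k\<close> is one of the reflection \<open>\<rho>\<close>,
  because \<open>\<rho> (c k) = c (\<pi>\<inverse> k)\<close>, \<open>\<rho>\<inverse> (c k) = c (\<pi> k)\<close> and \<open>c\<close> reverses the order, so that the two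
  defining inequalities change places (\<open>DD_antidiag\<close>).

  It carries occurrences of a pattern to occurrences of the reflected pattern
  (\<open>contains_pattern_antidiag\<close>). The patterns 123, 321, 231 and 312 are symmetric about the
  antidiagonal, whereas 132 and 213 are mirror images of each other. So for every set \<open>S\<close> of
  symmetric patterns the reflection is a bijection that preserves \<open>DD\<close>, from the permutations
  avoiding \<open>S \<union> {132}\<close> to those avoiding \<open>S \<union> {213}\<close>.
\<close>

definition flip :: "nat \<Rightarrow> nat \<Rightarrow> nat" where
  "flip n k = (if k \<in> {1..n} then Suc n - k else k)"

definition antidiag :: "nat \<Rightarrow> (nat \<Rightarrow> nat) \<Rightarrow> nat \<Rightarrow> nat" where
  "antidiag n \<pi> = flip n \<circ> inv \<pi> \<circ> flip n"

lemma flip_flip [simp]: "flip n (flip n k) = k"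
  by (auto simp: flip_def)

lemma flip_permutes: "flip n permutes {1..n}"
  by (rule bij_imp_permutes, rule bij_betwI[where g = "flip n"]) (auto simp: flip_def)

lemma antidiag_permutes:
  assumes "\<pi> permutes {1..n}"
  shows "antidiag n \<pi> permutes {1..n}"
  unfolding antidiag_def
  by (intro permutes_compose flip_permutes permutes_inv assms)

lemma inv_antidiag:
  assumes "\<pi> permutes {1..n}"
  shows "inv (antidiag n \<pi>) = flip n \<circ> \<pi> \<circ> flip n"
  using permutes_inv_o[OF assms]
  by (intro inv_unique_comp) (auto simp: antidiag_def fun_eq_iff)

lemma antidiag_antidiag:
  assumes "\<pi> permutes {1..n}"
  shows "antidiag n (antidiag n \<pi>) = \<pi>"
  using inv_antidiag[OF assms] by (auto simp: antidiag_def[of n "antidiag n \<pi>"] fun_eq_iff)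

lemma DD_antidiag:
  assumes "\<pi> permutes {1..n}"
  shows "DD n (antidiag n \<pi>) = DD n \<pi>"
proof -
  have eq: "(antidiag n \<pi> (flip n k) < flip n k \<and> flip n k < inv (antidiag n \<pi>) (flip n k))
        \<longleftrightarrow> (\<pi> k < k \<and> k < inv \<pi> k)" if k: "k \<in> {1..n}" for k
    using k permutes_in_image[OF assms, of k] permutes_in_image[OF permutes_inv[OF assms], of k]
    unfolding inv_antidiag[OF assms] by (auto simp: antidiag_def flip_def)
  have flip_in: "flip n k \<in> {1..n}" if "k \<in> {1..n}" for k
    using that by (auto simp: flip_def)
  have "bij_betw (flip n) {k \<in> {1..n}. \<pi> k < k \<and> k < inv \<pi> k}
     {k \<in> {1..n}. antidiag n \<pi> k < k \<and> k < inv (antidiag n \<pi>) k}"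
  proof (rule bij_betwI[where g = "flip n"])
    show "flip n \<in> {k \<in> {1..n}. \<pi> k < k \<and> k < inv \<pi> k} \<rightarrow>
        {k \<in> {1..n}. antidiag n \<pi> k < k \<and> k < inv (antidiag n \<pi>) k}"
      using eq flip_in by blast
    show "flip n \<in> {k \<in> {1..n}. antidiag n \<pi> k < k \<and> k < inv (antidiag n \<pi>) k} \<rightarrow>
        {k \<in> {1..n}. \<pi> k < k \<and> k < inv \<pi> k}"
    proof
      fix k assume "k \<in> {k \<in> {1..n}. antidiag n \<pi> k < k \<and> k < inv (antidiag n \<pi>) k}"
      then show "flip n k \<in> {k \<in> {1..n}. \<pi> k < k \<and> k < inv \<pi> k}"
        using eq[of "flip n k"] flip_in[of k] by simp
    qed
  qed auto
  from bij_betw_same_card[OF this] show ?thesis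
    unfolding DD_def by (rule sym)
qed

text \<open>
  Avoidance is easier to transport in terms of the positions of an occurrence than in terms of
  its word of values, since the reflection exchanges positions and values.
\<close>

lemma contains_pattern_one_line_iff:
  "contains_pattern (one_line n \<pi>) u \<longleftrightarrow>
     (\<exists>ks. sorted_wrt (<) ks \<and> set ks \<subseteq> {1..n} \<and> order_isomorphic (map \<pi> ks) u)"
proof
  assume "contains_pattern (one_line n \<pi>) u"
  then obtain N where N: "order_isomorphic (nths (map \<pi> [1..<Suc n]) N) u"
    unfolding contains_pattern_def one_line_def subseq_conv_nths by blast
  define ks where "ks = nths [1..<Suc n] N"
  have "sorted_wrt (<) ks"
    unfolding strict_sorted_iff ks_def by (intro conjI sorted_nths distinct_nthsI) (simp_all del: upt_Suc)
  moreover have "set ks \<subseteq> {1..n}"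
    unfolding ks_def by (rule order_trans[OF set_nths_subset]) auto
  ultimately show "\<exists>ks. sorted_wrt (<) ks \<and> set ks \<subseteq> {1..n} \<and> order_isomorphic (map \<pi> ks) u"
    using N unfolding nths_map ks_def by blast
next
  assume "\<exists>ks. sorted_wrt (<) ks \<and> set ks \<subseteq> {1..n} \<and> order_isomorphic (map \<pi> ks) u"
  then obtain ks where ks: "sorted_wrt (<) ks" "set ks \<subseteq> {1..n}" "order_isomorphic (map \<pi> ks) u"
    by blast
  have "ks = filter (\<lambda>k. k \<in> set ks) [1..<Suc n]"
    by (rule sorted_distinct_set_unique) (use ks in \<open>auto simp: strict_sorted_iff sorted_wrt_filter simp del: upt_Suc\<close>)
  then have "subseq ks [1..<Suc n]"
    by (metis subseq_filter_left)
  then have "subseq (map \<pi> ks) (one_line n \<pi>)"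
    unfolding one_line_def by (rule subseq_map)
  then show "contains_pattern (one_line n \<pi>) u"
    unfolding contains_pattern_def using ks(3) by blast
qed

text \<open>
  Two patterns \<open>u\<close> and \<open>v\<close> of length \<open>m\<close> are mirror images in the antidiagonal. Entry \<open>i\<close> of a
  list is the point \<open>(i + 1, u ! i)\<close> of the plot, whose reflection
  \<open>(m + 1 - u ! i, m - i)\<close> is entry \<open>m - u ! i\<close> of the other list.
\<close>

definition mirror_patterns :: "nat list \<Rightarrow> nat list \<Rightarrow> bool" where
  "mirror_patterns u v \<longleftrightarrow> length u = length v \<and>
     (\<forall>i<length u. u ! i \<in> {1..length u} \<and> v ! (length u - u ! i) = length u - i) \<and>
     (\<forall>i<length v. v ! i \<in> {1..length v} \<and> u ! (length v - v ! i) = length v - i)"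

lemma mirror_patterns_sym: "mirror_patterns u v \<Longrightarrow> mirror_patterns v u"
  by (auto simp: mirror_patterns_def)

text \<open>
  If \<open>u\<close> occurs at the positions \<open>ks\<close>, reflecting the points of this occurrence and listing them
  from left to right again gives an occurrence of \<open>v\<close>: its point number \<open>j\<close> is the reflection
  of point number \<open>m - v ! j\<close> of the old one.
\<close>

lemma contains_pattern_antidiag:
  assumes \<pi>: "\<pi> permutes {1..n}" and uv: "mirror_patterns u v"
    and u: "contains_pattern (one_line n \<pi>) u"
  shows "contains_pattern (one_line n (antidiag n \<pi>)) v"
proof -
  define m where "m = length u"
  obtain ks where sorted: "sorted_wrt (<) ks" and ks: "set ks \<subseteq> {1..n}"
    and iso: "order_isomorphic (map \<pi> ks) u"
    using u unfolding contains_pattern_one_line_iff by blast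
  have len: "length ks = m" "length v = m"
    using iso uv by (auto simp: order_isomorphic_def mirror_patterns_def m_def)
  define t where "t j = m - v ! j" for j
  have v: "v ! j \<in> {1..m}" and ut: "u ! t j = m - j" and t: "t j < m" if "j < m" for j
    using that uv len by (auto simp: mirror_patterns_def m_def t_def)
  have ks_in: "ks ! i \<in> {1..n}" "\<pi> (ks ! i) \<in> {1..n}" if "i < m" for i
  proof -
    show "ks ! i \<in> {1..n}"
      using that len ks nth_mem[of i ks] by blast
    then show "\<pi> (ks ! i) \<in> {1..n}"
      using permutes_in_image[OF \<pi>] by blast
  qed
  have ks_less: "ks ! i < ks ! j \<longleftrightarrow> i < j" if "i < m" "j < m" for i j
    using that sorted len by (metis linorder_neqE_nat less_asym sorted_wrt_nth_less)
  have \<pi>_less: "\<pi> (ks ! i) < \<pi> (ks ! j) \<longleftrightarrow> u ! i < u ! j" if "i < m" "j < m" for i j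
    using that iso len by (auto simp: order_isomorphic_def)
  define js where "js = map (\<lambda>j. flip n (\<pi> (ks ! t j))) [0..<m]"
  have js_nth: "js ! j = Suc n - \<pi> (ks ! t j)" if "j < m" for j
    using that ks_in(2)[OF t[OF that]] by (simp add: js_def flip_def)
  have val: "antidiag n \<pi> (js ! j) = Suc n - ks ! t j" if "j < m" for j
    using that ks_in(1)[OF t[OF that]] permutes_inverses(2)[OF \<pi>]
    by (simp add: js_def antidiag_def) (simp add: flip_def)
  have "sorted_wrt (<) js"
    unfolding sorted_wrt_iff_nth_less
  proof (intro allI impI)
    fix a b assume "a < b" "b < length js"
    then have ab: "a < b" "a < m" "b < m" by (auto simp: js_def)
    have "\<pi> (ks ! t b) < \<pi> (ks ! t a)"
      using ab \<pi>_less t ut by simp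
    then show "js ! a < js ! b"
      using ab js_nth ks_in(2)[OF t] by (simp add: diff_less_mono2 less_Suc_eq_le)
  qed
  moreover have "set js \<subseteq> {1..n}"
    using ks_in(2)[OF t] by (force simp: js_def flip_def)
  moreover have "order_isomorphic (map (antidiag n \<pi>) js) v"
    unfolding order_isomorphic_def
  proof (intro conjI allI impI)
    show "length (map (antidiag n \<pi>) js) = length v"
      by (simp add: js_def len)
    fix a b assume "a < length (map (antidiag n \<pi>) js)" "b < length (map (antidiag n \<pi>) js)"
    then have ab: "a < m" "b < m" and ab': "a < length js" "b < length js" by (auto simp: js_def)
    have "map (antidiag n \<pi>) js ! a < map (antidiag n \<pi>) js ! b \<longleftrightarrow> ks ! t b < ks ! t a"
      using ab ab' val ks_in(1)[OF t[OF ab(1)]] ks_in(1)[OF t[OF ab(2)]] by auto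
    also have "\<dots> \<longleftrightarrow> t b < t a"
      using ab ks_less t by simp
    also have "\<dots> \<longleftrightarrow> v ! a < v ! b"
      using v[OF ab(1)] v[OF ab(2)] by (auto simp: t_def)
    finally show "map (antidiag n \<pi>) js ! a < map (antidiag n \<pi>) js ! b \<longleftrightarrow> v ! a < v ! b" .
  qed
  ultimately show ?thesis
    unfolding contains_pattern_one_line_iff by blast
qed

lemma antidiag_in_Av:
  assumes "\<pi> \<in> Av n T" and mirror: "\<And>v. v \<in> T' \<Longrightarrow> \<exists>u\<in>T. mirror_patterns u v"
  shows "antidiag n \<pi> \<in> Av n T'"
proof -
  have \<pi>: "\<pi> permutes {1..n}" and avoids: "\<And>u. u \<in> T \<Longrightarrow> \<not> contains_pattern (one_line n \<pi>) u"
    using assms(1) by (auto simp: Av_def)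
  have "\<not> contains_pattern (one_line n (antidiag n \<pi>)) v" if "v \<in> T'" for v
  proof
    assume v: "contains_pattern (one_line n (antidiag n \<pi>)) v"
    obtain u where u: "u \<in> T" "mirror_patterns u v"
      using mirror \<open>v \<in> T'\<close> by blast
    have "contains_pattern (one_line n \<pi>) u"
      using contains_pattern_antidiag[OF antidiag_permutes[OF \<pi>] mirror_patterns_sym[OF u(2)] v]
      unfolding antidiag_antidiag[OF \<pi>] .
    then show False using avoids u(1) by blast
  qed
  then show ?thesis
    using antidiag_permutes[OF \<pi>] by (auto simp: Av_def)
qed

lemma DD_poly_mirror:
  assumes "\<And>u. u \<in> T \<Longrightarrow> \<exists>v\<in>T'. mirror_patterns u v"
    and "\<And>v. v \<in> T' \<Longrightarrow> \<exists>u\<in>T. mirror_patterns u v"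
  shows "DD_poly T n = DD_poly T' n"
  unfolding DD_poly_def
proof (rule sum.reindex_bij_witness[where i = "antidiag n" and j = "antidiag n"])
  have permutes: "\<pi> permutes {1..n}" if "\<pi> \<in> Av n U" for \<pi> U
    using that by (simp add: Av_def)
  show "antidiag n (antidiag n \<pi>) = \<pi>" if "\<pi> \<in> Av n T" for \<pi>
    by (rule antidiag_antidiag[OF permutes[OF that]])
  show "antidiag n (antidiag n \<pi>) = \<pi>" if "\<pi> \<in> Av n T'" for \<pi>
    by (rule antidiag_antidiag[OF permutes[OF that]])
  show "antidiag n \<pi> \<in> Av n T'" if "\<pi> \<in> Av n T" for \<pi>
    by (rule antidiag_in_Av[OF that assms(2)])
  have "\<exists>v\<in>T'. mirror_patterns v u" if "u \<in> T" for u
    using assms(1)[OF that] mirror_patterns_sym by blast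
  then show "antidiag n \<pi> \<in> Av n T" if "\<pi> \<in> Av n T'" for \<pi>
    by (rule antidiag_in_Av[OF that])
  show "monom 1 (DD n (antidiag n \<pi>)) = monom (1::int) (DD n \<pi>)" if "\<pi> \<in> Av n T" for \<pi>
    by (simp only: DD_antidiag[OF permutes[OF that]])
qed

lemma mirror_patterns_length_3:
  "mirror_patterns [1,2,3] [1,2,3]" "mirror_patterns [3,2,1] [3,2,1]"
  "mirror_patterns [2,3,1] [2,3,1]" "mirror_patterns [3,1,2] [3,1,2]"
  "mirror_patterns [1,3,2] [2,1,3]"
  by (simp_all add: mirror_patterns_def All_less_Suc)

theorem corollary11:
  fixes S :: "nat list set"
  assumes "S \<subseteq> {[1,2,3], [3,2,1], [2,3,1], [3,1,2]}"
  shows "(\<forall>n. DD_poly (S \<union> {[1,3,2]}) n = DD_poly (S \<union> {[2,1,3]}) n) \<and>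
         DD_Wilf_equivalent (S \<union> {[1,3,2]}) (S \<union> {[2,1,3]})"
proof -
  have "mirror_patterns u u" if "u \<in> S" for u
    using that assms mirror_patterns_length_3 by blast
  then have "DD_poly (S \<union> {[1,3,2]}) n = DD_poly (S \<union> {[2,1,3]}) n" for n
    by (intro DD_poly_mirror) (use mirror_patterns_length_3(5) in blast)+
  then show ?thesis
    by (simp add: DD_Wilf_equivalent_def)
qed

end
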